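(* Fix $r\in\mathbb{N}$ and let $w=n^\alpha$ for some fixed $\alpha\in\left(\frac12,1\right)$. In addition, let $$N:=\binom{n}{w},\qquad D:=\sum_{s=0}^{w-1}\frac{w!\,(n-w)!}{(r-1)!\,s!\,[(w-s)!]^{r}\,[n-rw+(r-1)s]!},$$ where $N$ is the number of (possible) edges, and $D$ denotes the number of $r$-sunflowers containing a fixed edge. Then, as $n\to\infty$, $$\Pr\left(\mathbb{H}_{n,p,w}\text{ contains an } r\text{-sunflower}\right)\to\begin{cases}0 & \text{if } p=o\left((ND)^{-1/r}\right),\\ 1 & \text{if } p=\omega\left((ND)^{-1/r}\right).\end{cases}$$
   Context: An $r$-sunflower is a collection of $r$ sets such that the intersection of any two sets in the collection is identical; here the sets are $w$-element subsets (edges) of a universe of $n$ points. $\mathbb{H}_{n,p,w}$ denotes the random $w$-uniform hypergraph on $n$ vertices in which each of the $\binom{n}{w}$ possible edges is chosen independently with probability $p$.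
   Formalization: The claim is proved for r ≥ 2: for r = 0 the formula for D contains (-1)!, and for r = 1 it gives D = 2^w - 1, for which the second limit fails (p = 1/(N√D)); w is n^α rounded to an adjacent integer. *)

theory Defs
  imports "HOL-Probability.Probability" "HOL-Library.Landau_Symbols"
begin

definition sunflower :: "nat \<Rightarrow> 'a set set \<Rightarrow> bool" where
  "sunflower r S \<longleftrightarrow>
     finite S \<and> card S = r \<and> (\<exists>K. \<forall>A\<in>S. \<forall>B\<in>S. A \<noteq> B \<longrightarrow> A \<inter> B = K)"

definition contains_sunflower :: "nat \<Rightarrow> 'a set set \<Rightarrow> bool" where
  "contains_sunflower r H \<longleftrightarrow> (\<exists>S\<subseteq>H. sunflower r S)"

definition possible_edges :: "nat \<Rightarrow> nat \<Rightarrow> nat set set" where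
  "possible_edges n w = {e. e \<subseteq> {..<n} \<and> card e = w}"

text \<open>A hypergraph is identified with its set of edges; the vertex set is \<open>{..<n}\<close>.\<close>

definition random_hypergraph :: "nat \<Rightarrow> real \<Rightarrow> nat \<Rightarrow> nat set set pmf" where
  "random_hypergraph n p w =
     map_pmf (\<lambda>f. {e \<in> possible_edges n w. f e})
       (Pi_pmf (possible_edges n w) False (\<lambda>_. bernoulli_pmf p))"

definition num_edges :: "nat \<Rightarrow> nat \<Rightarrow> nat" where
  "num_edges n w = n choose w"

text \<open>
  For \<open>r \<ge> 2\<close> and \<open>w \<le> n\<close> this is the number of \<open>r\<close>-sunflowers in \<open>possible_edges n w\<close>
  containing a fixed edge; \<open>s\<close> is the size of the kernel. The summand is zero when
  \<open>n - r w + (r - 1) s\<close> is negative (there is no room for the petals); this has to be spelled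
  out because subtraction on \<open>nat\<close> truncates.
\<close>

definition sunflower_degree :: "nat \<Rightarrow> nat \<Rightarrow> nat \<Rightarrow> real" where
  "sunflower_degree r n w =
     (\<Sum>s<w. if r * w \<le> n + (r - 1) * s
            then fact w * fact (n - w) /
                 (fact (r - 1) * fact s * fact (w - s) ^ r * fact (n + (r - 1) * s - r * w))
            else 0)"

end

theory Submission
  imports Defs "HOL-Real_Asymp.Real_Asymp"
begin

text \<open>
  First and second moment method for the number of labelled sunflowers (kernel plus ordered list of
  petals), of which there are \<open>T = (r - 1)! N D\<close>. The first moment \<open>T p\<^sup>r\<close> gives the first limit.
  For the second, put \<open>T = z\<^sup>r\<close> and bound, for a fixed labelled sunflower, the number of those
  sharing exactly \<open>j\<close> edges with it by \<open>O(z\<^bsup>r-j\<^esup>)\<close>, uniformly in \<open>n\<close> and \<open>w\<close>; then the variance is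
  \<open>O(1 / (p z))\<close> times the squared mean. If \<open>j \<ge> 2\<close>, the shared edges determine the kernel, so only the
  last \<open>r - j\<close> petals remain to be chosen. The number \<open>c\<^sub>i\<close> of choices for petal \<open>i\<close> decreases
  with \<open>i\<close>, hence \<open>(c\<^sub>j \<cdots> c\<^bsub>r-1\<^esub>)\<^sup>r \<le> (c\<^sub>0 \<cdots> c\<^bsub>r-1\<^esub>)\<^bsup>r-j\<^esup> \<le> T\<^bsup>r-j\<^esup>\<close>. If \<open>j = 1\<close>, symmetry between
  the edges gives the bound \<open>r\<^sup>2 T / N\<close>, and \<open>T \<le> N\<^sup>r\<close>, i.e. \<open>z \<le> N\<close>.
\<close>

section \<open>Ordered lists of disjoint blocks of equal size, and their enumeration\<close>

fun packing :: "'a set \<Rightarrow> nat \<Rightarrow> 'a set list \<Rightarrow> bool" where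
  "packing U m [] \<longleftrightarrow> True"
| "packing U m (p # ps) \<longleftrightarrow> p \<subseteq> U \<and> card p = m \<and> packing (U - p) m ps"

lemma packing_memD:
  assumes "packing U m ps" "q \<in> set ps"
  shows "q \<subseteq> U" "card q = m"
proof -
  have "q \<subseteq> U \<and> card q = m"
    using assms by (induction ps arbitrary: U) auto
  then show "q \<subseteq> U" "card q = m" by auto
qed

lemma packing_disjoint:
  assumes "packing U m ps" "q \<in> set ps" "q' \<in> set ps" "q \<noteq> q'"
  shows "q \<inter> q' = {}"
  using assms
proof (induction ps arbitrary: U)
  case (Cons p ps)
  have "p \<inter> x = {}" if "x \<in> set ps" for x
    using packing_memD(1)[of "U - p" m ps x] Cons.prems(1) that by auto
  then show ?case using Cons by fastforce
qed simp

text \<open>A nonempty block cannot recur, because the later blocks avoid its points; for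
  \<open>m = 0\<close> the empty block could be repeated.\<close>

lemma packing_distinct: "packing U m ps \<Longrightarrow> m > 0 \<Longrightarrow> distinct ps"
proof (induction ps arbitrary: U)
  case (Cons p ps)
  have "p \<noteq> {}" using Cons.prems by auto
  then have "p \<notin> set ps"
    using packing_memD(1)[of "U - p" m ps p] Cons.prems by auto
  then show ?case using Cons by auto
qed simp

lemma packingI:
  assumes "distinct ps" "\<And>p. p \<in> set ps \<Longrightarrow> p \<subseteq> U \<and> card p = m"
    and "\<And>p q. p \<in> set ps \<Longrightarrow> q \<in> set ps \<Longrightarrow> p \<noteq> q \<Longrightarrow> p \<inter> q = {}"
  shows "packing U m ps"
  using assms
proof (induction ps arbitrary: U)
  case (Cons p ps)
  have "packing (U - p) m ps"
  proof (rule Cons.IH)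
    fix q assume q: "q \<in> set ps"
    then have "p \<noteq> q" using Cons.prems(1) by auto
    then have "p \<inter> q = {}" using Cons.prems(3)[of p q] q by auto
    then show "q \<subseteq> U - p \<and> card q = m" using Cons.prems(2)[of q] q by auto
  qed (use Cons.prems in auto)
  then show ?case using Cons.prems by auto
qed simp

text \<open>The blocks in \<open>Q\<close> must occur in the list, at any positions.
  \<open>Q = {}\<close> gives all lists, a singleton serves for sunflowers through a given edge, and
  a larger \<open>Q\<close> for the petals shared by two sunflowers.\<close>

definition packings :: "'a set \<Rightarrow> nat \<Rightarrow> nat \<Rightarrow> 'a set set \<Rightarrow> 'a set list set" where
  "packings U m r Q = {ps. length ps = r \<and> packing U m ps \<and> Q \<subseteq> set ps}"

lemma finite_packings [simp, intro]:
  assumes "finite U"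
  shows "finite (packings U m r Q)"
proof (rule finite_subset)
  show "packings U m r Q \<subseteq> {ps. set ps \<subseteq> Pow U \<and> length ps = r}"
    using packing_memD(1) by (fastforce simp: packings_def)
  show "finite {ps. set ps \<subseteq> Pow U \<and> length ps = r}"
    using assms by (intro finite_lists_length_eq) auto
qed

lemma packings_Suc:
  "packings U m (Suc r) Q = (\<Union>p\<in>{p. p \<subseteq> U \<and> card p = m}. (#) p ` packings (U - p) m r (Q - {p}))"
proof (intro equalityI subsetI)
  fix xs assume "xs \<in> packings U m (Suc r) Q"
  then show "xs \<in> (\<Union>p\<in>{p. p \<subseteq> U \<and> card p = m}. (#) p ` packings (U - p) m r (Q - {p}))"
    by (cases xs) (auto simp: packings_def)
qed (auto simp: packings_def)

text \<open>The prescribed blocks can be placed in \<open>fact (card Q) * (r choose card Q)\<close>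
  ways. The free blocks are then chosen one by one from the points left over,
  \<open>card Q * m\<close> points being reserved from the start. The induction on \<open>r\<close>
  distinguishes whether the first block belongs to \<open>Q\<close>.\<close>

lemma card_packings:
  assumes "finite U" "m > 0" "finite Q" "\<And>q. q \<in> Q \<Longrightarrow> q \<subseteq> U \<and> card q = m"
    and "\<And>q q'. q \<in> Q \<Longrightarrow> q' \<in> Q \<Longrightarrow> q \<noteq> q' \<Longrightarrow> q \<inter> q' = {}"
  shows "card (packings U m r Q) =
           fact (card Q) * (r choose card Q) * (\<Prod>i=card Q..<r. (card U - i * m) choose m)"
  using assms(1,3-)
proof (induction r arbitrary: U Q)
  case 0
  show ?case
  proof (cases "Q = {}")
    case True
    have "packings U m 0 Q = {[]}" using True by (auto simp: packings_def)
    then show ?thesis using True by simp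
  next
    case False
    then have "packings U m 0 Q = {}" by (auto simp: packings_def)
    then show ?thesis using False 0 by (simp add: card_gt_0_iff)
  qed
next
  case (Suc r)
  define P where "P = {p. p \<subseteq> U \<and> card p = m}"
  define j where "j = card Q"
  have finP: "finite P" unfolding P_def using Suc.prems(1) by auto
  have QP: "Q \<subseteq> P" using Suc.prems(3) by (auto simp: P_def)
  have UQ: "card (\<Union>Q) = j * m"
  proof -
    have "card (\<Union>Q) = (\<Sum>q\<in>Q. card q)"
      using Suc.prems by (intro card_Union_disjoint) (auto simp: pairwise_def disjnt_def dest: finite_subset)
    then show ?thesis using Suc.prems(3) by (simp add: j_def)
  qed
  have nonempty: "p \<noteq> {}" if "p \<in> P" for p using that assms(2) by (auto simp: P_def)
  \<comment> \<open>The admissible first blocks outside \<open>Q\<close>: they must leave every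
    point of the prescribed blocks available.\<close>
  define R where "R = {p \<in> P. p \<inter> \<Union>Q = {}}"
  have R: "card R = (card U - j * m) choose m"
  proof -
    have "R = {p. p \<subseteq> U - \<Union>Q \<and> card p = m}" by (auto simp: R_def P_def)
    moreover have "card (U - \<Union>Q) = card U - j * m"
      using Suc.prems by (subst card_Diff_subset) (auto simp: UQ intro: finite_subset[of "\<Union>Q" U])
    ultimately show ?thesis using Suc.prems(1) by (simp add: n_subsets)
  qed
  have disj: "Q \<inter> R = {}" using nonempty QP by (auto simp: R_def)
  have "card (packings U m (Suc r) Q) = (\<Sum>p\<in>P. card ((#) p ` packings (U - p) m r (Q - {p})))"
    unfolding packings_Suc P_def[symmetric] using finP Suc.prems(1)
    by (intro card_UN_disjoint) auto
  also have "\<dots> = (\<Sum>p\<in>P. card (packings (U - p) m r (Q - {p})))"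
    by (intro sum.cong refl card_image) (auto simp: inj_on_def)
  \<comment> \<open>A first block outside \<open>Q\<close> that meets some \<open>q\<close> in
    \<open>Q\<close> prevents \<open>q\<close> from occurring later, so it contributes
    nothing.\<close>
  also have "\<dots> = (\<Sum>p\<in>Q \<union> R. card (packings (U - p) m r (Q - {p})))"
  proof (rule sum.mono_neutral_right[OF finP])
    show "Q \<union> R \<subseteq> P" using QP by (auto simp: R_def)
    show "\<forall>p\<in>P - (Q \<union> R). card (packings (U - p) m r (Q - {p})) = 0"
    proof
      fix p assume p: "p \<in> P - (Q \<union> R)"
      then obtain q where q: "q \<in> Q" "p \<inter> q \<noteq> {}" by (auto simp: R_def)
      have "\<not> q \<subseteq> U - p" "q \<noteq> p" using q p by auto
      then have "packings (U - p) m r (Q - {p}) = {}"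
        using q packing_memD(1) by (fastforce simp: packings_def)
      then show "card (packings (U - p) m r (Q - {p})) = 0" by simp
    qed
  qed
  also have "\<dots> = (\<Sum>p\<in>Q. card (packings (U - p) m r (Q - {p}))) + (\<Sum>p\<in>R. card (packings (U - p) m r (Q - {p})))"
    using disj finP QP by (intro sum.union_disjoint) (auto simp: R_def intro: finite_subset)
  also have "(\<Sum>p\<in>Q. card (packings (U - p) m r (Q - {p}))) =
      j * (fact (j - 1) * (r choose (j - 1)) * (\<Prod>i=j-1..<r. (card U - Suc i * m) choose m))"
  proof -
    have "card (packings (U - p) m r (Q - {p})) =
       fact (j - 1) * (r choose (j - 1)) * (\<Prod>i=j-1..<r. (card U - Suc i * m) choose m)" if p: "p \<in> Q" for p
    proof -
      have "card (packings (U - p) m r (Q - {p})) =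
        fact (card (Q - {p})) * (r choose card (Q - {p})) * (\<Prod>i=card (Q - {p})..<r. (card (U - p) - i * m) choose m)"
      proof (rule Suc.IH)
        show "q \<subseteq> U - p \<and> card q = m" if "q \<in> Q - {p}" for q
          using Suc.prems(4)[of p q] Suc.prems(3)[of q] p that by auto
        show "q \<inter> q' = {}" if "q \<in> Q - {p}" "q' \<in> Q - {p}" "q \<noteq> q'" for q q'
          using Suc.prems(4)[of q q'] that by auto
      qed (use Suc.prems in auto)
      moreover have "card (Q - {p}) = j - 1" using p Suc.prems by (simp add: j_def)
      moreover have "card (U - p) = card U - m"
        using Suc.prems p by (subst card_Diff_subset) (auto intro: finite_subset)
      ultimately show ?thesis by (simp add: diff_diff_eq)
    qed
    then show ?thesis by (simp add: j_def)
  qed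
  also have "(\<Sum>p\<in>R. card (packings (U - p) m r (Q - {p}))) =
      ((card U - j * m) choose m) * (fact j * (r choose j) * (\<Prod>i=j..<r. (card U - Suc i * m) choose m))"
  proof -
    have "card (packings (U - p) m r (Q - {p})) =
       fact j * (r choose j) * (\<Prod>i=j..<r. (card U - Suc i * m) choose m)" if p: "p \<in> R" for p
    proof -
      have [simp]: "Q - {p} = Q" using disj p by auto
      have "card (packings (U - p) m r Q) =
        fact (card Q) * (r choose card Q) * (\<Prod>i=card Q..<r. (card (U - p) - i * m) choose m)"
      proof (rule Suc.IH)
        show "q \<subseteq> U - p \<and> card q = m" if "q \<in> Q" for q
          using Suc.prems(3)[of q] p that by (auto simp: R_def)
      qed (use Suc.prems in auto)
      moreover have "card (U - p) = card U - m"
        using Suc.prems p by (subst card_Diff_subset) (auto simp: R_def P_def intro: finite_subset)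
      ultimately show ?thesis by (simp add: diff_diff_eq j_def)
    qed
    then show ?thesis by (simp add: R)
  qed
  \<comment> \<open>The choice of a free first block becomes the factor \<open>i = j\<close> of the
    product. For \<open>j > r\<close> both sides vanish, as \<open>r choose j = 0\<close>.\<close>
  also have "((card U - j * m) choose m) * (fact j * (r choose j) * (\<Prod>i=j..<r. (card U - Suc i * m) choose m)) =
      fact j * (r choose j) * (\<Prod>i=j..<Suc r. (card U - i * m) choose m)"
  proof (cases "j \<le> r")
    case True
    have "(\<Prod>i=j..<Suc r. (card U - i * m) choose m) =
        ((card U - j * m) choose m) * (\<Prod>i=Suc j..<Suc r. (card U - i * m) choose m)"
      using True by (intro prod.atLeast_Suc_lessThan) auto
    also have "(\<Prod>i=Suc j..<Suc r. (card U - i * m) choose m) = (\<Prod>i=j..<r. (card U - Suc i * m) choose m)"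
      by (rule prod.shift_bounds_Suc_ivl)
    finally show ?thesis by simp
  qed simp
  \<comment> \<open>After an index shift the two products agree, and the coefficients add up by
    Pascal's rule. For \<open>j = 0\<close> the first summand is zero.\<close>
  also have "j * (fact (j - 1) * (r choose (j - 1)) * (\<Prod>i=j-1..<r. (card U - Suc i * m) choose m)) +
       fact j * (r choose j) * (\<Prod>i=j..<Suc r. (card U - i * m) choose m) =
       fact j * (Suc r choose j) * (\<Prod>i=j..<Suc r. (card U - i * m) choose m)"
  proof (cases j)
    case (Suc k)
    have "(\<Prod>i=k..<r. (card U - Suc i * m) choose m) = (\<Prod>i=Suc k..<Suc r. (card U - i * m) choose m)"
      by (rule prod.shift_bounds_Suc_ivl[symmetric])
    then show ?thesis by (simp only: Suc) (simp add: algebra_simps)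
  qed simp
  finally show ?case by (simp add: j_def)
qed

section \<open>Labelled sunflowers: their number and their relation to sunflowers\<close>

text \<open>The condition \<open>card K < w\<close> keeps the petals nonempty. For
  \<open>r \<ge> 2\<close> a sunflower determines its kernel, so it is represented
  \<open>fact r\<close> times, once for each order of its petals.\<close>

definition labelled_sunflowers :: "nat \<Rightarrow> 'a set \<Rightarrow> nat \<Rightarrow> ('a set \<times> 'a set list) set" where
  "labelled_sunflowers r V w =
     (SIGMA K:{K. K \<subseteq> V \<and> card K < w}. packings (V - K) (w - card K) r {})"

definition edges_of :: "'a set \<times> 'a set list \<Rightarrow> 'a set set" where
  "edges_of t = (\<union>) (fst t) ` set (snd t)"

text \<open>
  The number of ways to append petals \<open>j, \<dots>, r - 1\<close> to a kernel of size \<open>s\<close> with \<open>j\<close> petals in an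
  \<open>n\<close>-set. If there is no room, a truncated difference makes one of the binomials vanish
  (for \<open>s < w\<close>).
\<close>

definition completions :: "nat \<Rightarrow> nat \<Rightarrow> nat \<Rightarrow> nat \<Rightarrow> nat \<Rightarrow> nat" where
  "completions n w s j r = (\<Prod>i=j..<r. (n - s - i * (w - s)) choose (w - s))"

lemma sum_subsets_by_card:
  fixes g :: "nat \<Rightarrow> nat"
  assumes "finite V"
  shows "(\<Sum>K | K \<subseteq> V \<and> card K < w. g (card K)) = (\<Sum>s<w. (card V choose s) * g s)"
proof -
  have "(\<Sum>K | K \<subseteq> V \<and> card K < w. g (card K)) =
      (\<Sum>s<w. \<Sum>K | K \<in> {K. K \<subseteq> V \<and> card K < w} \<and> card K = s. g (card K))"
    using assms by (intro sum.group[symmetric]) auto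
  also have "\<dots> = (\<Sum>s<w. \<Sum>K | K \<subseteq> V \<and> card K = s. g s)"
    by (intro sum.cong) auto
  finally show ?thesis using assms by (simp add: n_subsets)
qed

lemma card_packings_Diff:
  assumes "finite V" "K \<subseteq> V" "card K < w" "finite Q"
    and "\<And>q. q \<in> Q \<Longrightarrow> q \<subseteq> V - K \<and> card q = w - card K"
    and "\<And>q q'. q \<in> Q \<Longrightarrow> q' \<in> Q \<Longrightarrow> q \<noteq> q' \<Longrightarrow> q \<inter> q' = {}"
  shows "card (packings (V - K) (w - card K) r Q) =
           fact (card Q) * (r choose card Q) * completions (card V) w (card K) (card Q) r"
proof -
  have "card (V - K) = card V - card K"
    using assms by (intro card_Diff_subset) (auto intro: finite_subset)
  then show ?thesis
    using assms by (subst card_packings) (auto simp: completions_def)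
qed

lemma finite_labelled_sunflowers [simp, intro]: "finite V \<Longrightarrow> finite (labelled_sunflowers r V w)"
  unfolding labelled_sunflowers_def by (intro finite_SigmaI) auto

lemma card_labelled_sunflowers:
  assumes "finite V"
  shows "card (labelled_sunflowers r V w) = (\<Sum>s<w. (card V choose s) * completions (card V) w s 0 r)"
proof -
  have "card (labelled_sunflowers r V w) =
      (\<Sum>K | K \<subseteq> V \<and> card K < w. card (packings (V - K) (w - card K) r {}))"
    unfolding labelled_sunflowers_def using assms by (intro card_SigmaI) auto
  also have "\<dots> = (\<Sum>K | K \<subseteq> V \<and> card K < w. completions (card V) w (card K) 0 r)"
    using assms by (intro sum.cong refl) (subst card_packings_Diff, auto)
  finally show ?thesis
    using sum_subsets_by_card[OF assms, where g = "\<lambda>s. completions (card V) w s 0 r"] by simp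
qed

lemma labelled_sunflowersD:
  assumes "(K, ps) \<in> labelled_sunflowers r V w"
  shows "K \<subseteq> V" "card K < w" "length ps = r" "packing (V - K) (w - card K) ps"
  using assms by (auto simp: labelled_sunflowers_def packings_def)

text \<open>Adding \<open>K\<close> is undone by removing it. This carries cardinalities and
  intersections over from petals to edges.\<close>

lemma inj_on_Un_disjoint: "inj_on ((\<union>) K) {p. p \<inter> K = {}}"
  by (auto simp: inj_on_def)

lemma labelled_sunflower_petals:
  assumes "(K, ps) \<in> labelled_sunflowers r V w"
  shows "set ps \<subseteq> {p. p \<inter> K = {}}"
  using packing_memD(1)[OF labelled_sunflowersD(4)[OF assms]] by blast

lemma edges_of_subset:
  assumes "finite V" "t \<in> labelled_sunflowers r V w" "e \<in> edges_of t"
  shows "e \<subseteq> V" "card e = w"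
proof -
  obtain K ps where t: "t = (K, ps)" by (cases t)
  then obtain p where p: "p \<in> set ps" "e = K \<union> p" using assms(3) by (auto simp: edges_of_def)
  note D = labelled_sunflowersD[OF assms(2)[unfolded t]]
  have "p \<subseteq> V - K" "card p = w - card K" using packing_memD[OF D(4) p(1)] by auto
  moreover have "card (K \<union> p) = card K + card p"
    using assms(1) D(1) calculation(1) by (intro card_Un_disjoint) (auto intro: finite_subset)
  ultimately show "e \<subseteq> V" "card e = w" using D p by auto
qed

lemma card_edges_of:
  assumes "t \<in> labelled_sunflowers r V w"
  shows "card (edges_of t) = r"
proof -
  obtain K ps where t: "t = (K, ps)" by (cases t)
  note D = labelled_sunflowersD[OF assms[unfolded t]]
  have "card (edges_of t) = card (set ps)"
    unfolding edges_of_def t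
    using inj_on_subset[OF inj_on_Un_disjoint labelled_sunflower_petals[OF assms[unfolded t]]]
    by (simp add: card_image)
  also have "\<dots> = length ps" using packing_distinct[OF D(4)] D(2) by (simp add: distinct_card)
  finally show ?thesis using D by simp
qed

lemma finite_edges_of [simp, intro]: "finite (edges_of t)"
  by (simp add: edges_of_def)

lemma edges_of_inter:
  assumes "t \<in> labelled_sunflowers r V w" "e \<in> edges_of t" "e' \<in> edges_of t" "e \<noteq> e'"
  shows "e \<inter> e' = fst t"
proof -
  obtain K ps where t: "t = (K, ps)" by (cases t)
  obtain p p' where p: "p \<in> set ps" "e = K \<union> p" "p' \<in> set ps" "e' = K \<union> p'"
    using assms(2,3) t by (auto simp: edges_of_def)
  have "p \<inter> p' = {}"
    using packing_disjoint[OF labelled_sunflowersD(4)[OF assms(1)[unfolded t]]] p assms(4) by blast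
  then show ?thesis using p t by auto
qed

text \<open>Two distinct common edges intersect in the kernel of either sunflower.\<close>

lemma kernel_eq:
  assumes "t \<in> labelled_sunflowers r V w" "t' \<in> labelled_sunflowers r V w"
    and "card (edges_of t \<inter> edges_of t') \<ge> 2"
  shows "fst t = fst t'"
proof -
  obtain e e' where "e \<in> edges_of t \<inter> edges_of t'" "e' \<in> edges_of t \<inter> edges_of t'" "e \<noteq> e'"
    using assms(3) card_le_Suc0_iff_eq[of "edges_of t \<inter> edges_of t'"] by fastforce
  then show ?thesis using edges_of_inter[OF assms(1), of e e'] edges_of_inter[OF assms(2), of e e'] by auto
qed

lemma sunflower_edges_of:
  assumes "t \<in> labelled_sunflowers r V w"
  shows "sunflower r (edges_of t)"
  unfolding sunflower_def
proof (intro conjI exI[of _ "fst t"] ballI impI)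
  show "card (edges_of t) = r" by (rule card_edges_of[OF assms])
  show "A \<inter> B = fst t" if "A \<in> edges_of t" "B \<in> edges_of t" "A \<noteq> B" for A B
    using edges_of_inter[OF assms that] .
qed simp

text \<open>The common intersection is the kernel, and the sets \<open>A - K\<close> are the petals.
  Since all edges have size \<open>w\<close>, none contains another, so no petal is empty.\<close>

lemma sunflower_imp_labelled:
  assumes "finite V" "r \<ge> 2" "sunflower r S" "\<And>e. e \<in> S \<Longrightarrow> e \<subseteq> V \<and> card e = w"
  obtains t where "t \<in> labelled_sunflowers r V w" "edges_of t = S"
proof -
  obtain K where K: "\<And>A B. A \<in> S \<Longrightarrow> B \<in> S \<Longrightarrow> A \<noteq> B \<Longrightarrow> A \<inter> B = K"
    using assms(3) unfolding sunflower_def by metis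
  have S: "finite S" "card S = r" using assms(3) unfolding sunflower_def by auto
  \<comment> \<open>A second edge is what places \<open>K\<close> inside every edge; for a single
    edge the definition of \<open>sunflower\<close> leaves \<open>K\<close> arbitrary.\<close>
  have ex: "\<exists>B\<in>S. B \<noteq> A" for A
  proof (rule ccontr)
    assume "\<not> ?thesis"
    then have "S \<subseteq> {A}" by auto
    then have "card S \<le> 1" using card_mono[of "{A}" S] by simp
    then show False using S assms(2) by simp
  qed
  have KA: "K \<subset> A" if "A \<in> S" for A
  proof -
    obtain B where B: "B \<in> S" "B \<noteq> A" using ex by blast
    have "A \<inter> B = K" using K[of A B] B that by simp
    moreover have "\<not> A \<subseteq> B"
    proof
      assume "A \<subseteq> B"
      moreover have "finite B" using assms(4)[OF B(1)] assms(1) by (auto intro: finite_subset)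
      ultimately have "A = B" using assms(4)[OF B(1)] assms(4)[OF that] by (intro card_subset_eq) auto
      then show False using B by simp
    qed
    ultimately show ?thesis by auto
  qed
  obtain A0 where A0: "A0 \<in> S" using ex by blast
  have "finite A0" using assms(4)[OF A0] assms(1) by (auto intro: finite_subset)
  then have cK: "card K < w"
    using psubset_card_mono[of A0 K] KA[OF A0] assms(4)[OF A0] by simp
  obtain ps where ps: "set ps = (\<lambda>A. A - K) ` S" "distinct ps"
    using finite_distinct_list[of "(\<lambda>A. A - K) ` S"] S by auto
  have inj: "inj_on (\<lambda>A. A - K) S"
  proof (rule inj_onI)
    fix A B assume "A \<in> S" "B \<in> S" "A - K = B - K"
    then show "A = B" using KA[of A] KA[of B] by blast
  qed
  have "length ps = r" using distinct_card[OF ps(2)] ps(1) card_image[OF inj] S by simp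
  moreover have "packing (V - K) (w - card K) ps"
  proof (rule packingI[OF ps(2)])
    fix p assume "p \<in> set ps"
    then obtain A where A: "A \<in> S" "p = A - K" using ps by auto
    have "finite A" using assms(4)[OF A(1)] assms(1) by (auto intro: finite_subset)
    then have "card p = card A - card K"
      unfolding A(2) using KA[OF A(1)] by (intro card_Diff_subset) (auto intro: finite_subset)
    then show "p \<subseteq> V - K \<and> card p = w - card K" using A assms(4)[OF A(1)] by auto
  next
    fix p q assume "p \<in> set ps" "q \<in> set ps" "p \<noteq> q"
    then obtain A B where "A \<in> S" "p = A - K" "B \<in> S" "q = B - K" "A \<noteq> B" using ps by auto
    then show "p \<inter> q = {}" using K[of A B] by auto
  qed
  moreover have "K \<subseteq> V" using KA[OF A0] assms(4)[OF A0] by auto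
  ultimately have "(K, ps) \<in> labelled_sunflowers r V w"
    using cK by (auto simp: labelled_sunflowers_def packings_def)
  moreover have "edges_of (K, ps) = S"
  proof -
    have "K \<union> (A - K) = A" if "A \<in> S" for A using KA[OF that] by auto
    then show ?thesis by (auto simp: edges_of_def ps image_image)
  qed
  ultimately show ?thesis using that by blast
qed

text \<open>Mapping a labelled sunflower to its list of edges is injective: the edges determine the
  kernel by \<open>kernel_eq\<close>, and then the petals.\<close>

lemma card_labelled_sunflowers_le:
  assumes "finite V" "r \<ge> 2"
  shows "card (labelled_sunflowers r V w) \<le> (card V choose w) ^ r"
proof -
  let ?E = "{e. e \<subseteq> V \<and> card e = w}"
  have finE: "finite ?E" using assms by auto
  have "card (labelled_sunflowers r V w) \<le> card {xs. set xs \<subseteq> ?E \<and> length xs = r}"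
  proof (rule card_inj_on_le[where f = "\<lambda>t. map ((\<union>) (fst t)) (snd t)"])
    show "inj_on (\<lambda>t. map ((\<union>) (fst t)) (snd t)) (labelled_sunflowers r V w)"
    proof (rule inj_onI)
      fix t t' :: "'a set \<times> 'a set list"
      assume t: "t \<in> labelled_sunflowers r V w" "t' \<in> labelled_sunflowers r V w"
        and eq: "map ((\<union>) (fst t)) (snd t) = map ((\<union>) (fst t')) (snd t')"
      have "edges_of t = edges_of t'"
        using arg_cong[OF eq, of set] by (simp add: edges_of_def)
      then have K: "fst t = fst t'" using kernel_eq[OF t] card_edges_of[OF t(2)] assms(2) by simp
      obtain K ps ps' where tt: "t = (K, ps)" "t' = (K, ps')" using K by (cases t; cases t') auto
      have "inj_on ((\<union>) K) (set ps \<union> set ps')"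
        using labelled_sunflower_petals[OF t(1)[unfolded tt]] labelled_sunflower_petals[OF t(2)[unfolded tt]]
        by (intro inj_on_subset[OF inj_on_Un_disjoint]) auto
      then show "t = t'" using eq by (simp add: tt inj_on_map_eq_map)
    qed
    show "(\<lambda>t. map ((\<union>) (fst t)) (snd t)) ` labelled_sunflowers r V w \<subseteq> {xs. set xs \<subseteq> ?E \<and> length xs = r}"
    proof safe
      fix K ps assume t: "(K, ps) \<in> labelled_sunflowers r V w"
      show "length (map ((\<union>) (fst (K, ps))) (snd (K, ps))) = r"
        using labelled_sunflowersD(3)[OF t] by simp
      fix e assume "e \<in> set (map ((\<union>) (fst (K, ps))) (snd (K, ps)))"
      then have "e \<in> edges_of (K, ps)" by (simp add: edges_of_def)
      from edges_of_subset[OF assms(1) t this] show "card e = w" "\<And>x. x \<in> e \<Longrightarrow> x \<in> V" by auto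
    qed
  qed (use finE finite_lists_length_eq in auto)
  also have "\<dots> = (card V choose w) ^ r"
    using assms(1) card_lists_length_eq[OF finE, of r] by (simp add: n_subsets)
  finally show ?thesis .
qed

section \<open>Labelled sunflowers sharing a given number of edges with a fixed one\<close>

text \<open>By \<open>kernel_eq\<close> the kernel of \<open>t'\<close> is \<open>K\<close>, so only
  its petals vary. They include some \<open>j\<close>-subset \<open>J\<close> of the petals
  \<open>ps\<close>, and \<open>card_packings\<close> counts the lists containing \<open>J\<close>.
  Lists that share further petals are counted too, which is harmless for an upper bound.\<close>

lemma card_sharing_le:
  assumes "finite V" "(K, ps) \<in> labelled_sunflowers r V w" "j \<ge> 2"
  shows "card {t' \<in> labelled_sunflowers r V w. card (edges_of (K, ps) \<inter> edges_of t') = j}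
           \<le> (r choose j) * (fact j * (r choose j) * completions (card V) w (card K) j r)"
proof -
  note D = labelled_sunflowersD[OF assms(2)]
  let ?B = "\<Union>J\<in>{J. J \<subseteq> set ps \<and> card J = j}. packings (V - K) (w - card K) r J"
  have "{t' \<in> labelled_sunflowers r V w. card (edges_of (K, ps) \<inter> edges_of t') = j} \<subseteq> Pair K ` ?B"
  proof
    fix t' assume "t' \<in> {t' \<in> labelled_sunflowers r V w. card (edges_of (K, ps) \<inter> edges_of t') = j}"
    then have t': "t' \<in> labelled_sunflowers r V w" "card (edges_of (K, ps) \<inter> edges_of t') = j" by auto
    then obtain ps' where tt: "t' = (K, ps')"
      using kernel_eq[OF assms(2) t'(1)] assms(3) by (cases t') auto
    note D' = labelled_sunflowersD[OF t'(1)[unfolded tt]]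
    have "edges_of (K, ps) \<inter> edges_of t' = (\<union>) K ` (set ps \<inter> set ps')"
      unfolding tt edges_of_def
      using inj_on_image_Int[OF inj_on_Un_disjoint labelled_sunflower_petals[OF assms(2)]
          labelled_sunflower_petals[OF t'(1)[unfolded tt]]] by simp
    moreover have "inj_on ((\<union>) K) (set ps \<inter> set ps')"
      using labelled_sunflower_petals[OF assms(2)] by (intro inj_on_subset[OF inj_on_Un_disjoint]) auto
    ultimately have "card (set ps \<inter> set ps') = j" using t'(2) by (simp add: card_image)
    then have "ps' \<in> ?B"
      using D' by (intro UN_I[of "set ps \<inter> set ps'"]) (auto simp: packings_def)
    then show "t' \<in> Pair K ` ?B" using tt by auto
  qed
  then have "card {t' \<in> labelled_sunflowers r V w. card (edges_of (K, ps) \<inter> edges_of t') = j}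
      \<le> card (Pair K ` ?B)"
    using assms(1) by (intro card_mono) auto
  also have "\<dots> \<le> card ?B"
    using assms(1) by (intro card_image_le) auto
  also have "\<dots> \<le> (\<Sum>J\<in>{J. J \<subseteq> set ps \<and> card J = j}. card (packings (V - K) (w - card K) r J))"
    by (intro card_UN_le) auto
  also have "\<dots> = (\<Sum>J\<in>{J. J \<subseteq> set ps \<and> card J = j}. fact j * (r choose j) * completions (card V) w (card K) j r)"
  proof (intro sum.cong refl)
    fix J assume J: "J \<in> {J. J \<subseteq> set ps \<and> card J = j}"
    have "card (packings (V - K) (w - card K) r J) =
           fact (card J) * (r choose card J) * completions (card V) w (card K) (card J) r"
    proof (rule card_packings_Diff[OF assms(1) D(1,2)])
      show "finite J" using J by (auto intro: finite_subset)
      show "q \<subseteq> V - K \<and> card q = w - card K" if "q \<in> J" for q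
        using packing_memD[OF D(4), of q] J that by auto
      show "q \<inter> q' = {}" if "q \<in> J" "q' \<in> J" "q \<noteq> q'" for q q'
        using packing_disjoint[OF D(4), of q q'] J that by auto
    qed
    then show "card (packings (V - K) (w - card K) r J) =
        fact j * (r choose j) * completions (card V) w (card K) j r" using J by simp
  qed
  also have "\<dots> = (card (set ps) choose j) * (fact j * (r choose j) * completions (card V) w (card K) j r)"
    by (simp add: n_subsets)
  also have "card (set ps) = r"
    using packing_distinct[OF D(4)] D(2,3) by (simp add: distinct_card)
  finally show ?thesis .
qed

text \<open>The kernel is a proper subset of \<open>e\<close>, and \<open>e - K\<close> is a
  prescribed petal; the factor \<open>r\<close> is its position in the list.\<close>

lemma card_containing_edge:
  assumes "finite V" "e \<subseteq> V" "card e = w"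
  shows "card {t' \<in> labelled_sunflowers r V w. e \<in> edges_of t'}
           \<le> (\<Sum>s<w. (w choose s) * (r * completions (card V) w s 1 r))"
proof -
  have fe: "finite e" using assms finite_subset by blast
  let ?B = "SIGMA K:{K. K \<subseteq> e \<and> card K < w}. packings (V - K) (w - card K) r {e - K}"
  have "{t' \<in> labelled_sunflowers r V w. e \<in> edges_of t'} \<subseteq> ?B"
  proof
    fix t assume t: "t \<in> {t' \<in> labelled_sunflowers r V w. e \<in> edges_of t'}"
    obtain K ps where tt: "t = (K, ps)" by (cases t)
    have tL: "(K, ps) \<in> labelled_sunflowers r V w" using t tt by simp
    obtain p where p: "p \<in> set ps" "e = K \<union> p" using t tt by (auto simp: edges_of_def)
    have "e - K = p" using labelled_sunflower_petals[OF tL] p by auto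
    then show "t \<in> ?B" using labelled_sunflowersD[OF tL] p by (auto simp: tt packings_def)
  qed
  then have "card {t' \<in> labelled_sunflowers r V w. e \<in> edges_of t'} \<le> card ?B"
    using assms fe by (intro card_mono finite_SigmaI) auto
  also have "\<dots> = (\<Sum>K | K \<subseteq> e \<and> card K < w. card (packings (V - K) (w - card K) r {e - K}))"
    using assms fe by (intro card_SigmaI) auto
  also have "\<dots> = (\<Sum>K | K \<subseteq> e \<and> card K < w. r * completions (card V) w (card K) 1 r)"
  proof (intro sum.cong refl)
    fix K assume K: "K \<in> {K. K \<subseteq> e \<and> card K < w}"
    have "card (e - K) = w - card K"
      using K fe assms by (subst card_Diff_subset) (auto intro: finite_subset)
    then show "card (packings (V - K) (w - card K) r {e - K}) = r * completions (card V) w (card K) 1 r"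
      using K assms by (subst card_packings_Diff) auto
  qed
  also have "\<dots> = (\<Sum>s<w. (w choose s) * (r * completions (card V) w s 1 r))"
    using sum_subsets_by_card[OF fe, where g = "\<lambda>s. r * completions (card V) w s 1 r"] assms(3) by simp
  finally show ?thesis .
qed

text \<open>Double counting of the pairs of an edge and an \<open>s\<close>-subset of it, the prospective kernel.\<close>

lemma choose_mult_completions:
  assumes "s < w" "w \<le> n" "r \<ge> 1"
  shows "(n choose w) * ((w choose s) * completions n w s 1 r) = (n choose s) * completions n w s 0 r"
proof -
  have "completions n w s 0 r = ((n - s) choose (w - s)) * completions n w s 1 r"
    unfolding completions_def using assms by (subst prod.atLeast_Suc_lessThan) auto
  then show ?thesis using choose_mult[of s w n] assms by (simp add: mult.assoc[symmetric])
qed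

text \<open>A union bound over the \<open>r\<close> edges of \<open>t\<close>, followed by double
  counting. The second factor \<open>r\<close> is the position of the shared edge in
  \<open>t'\<close>.\<close>

lemma card_sharing_one_le:
  assumes "finite V" "t \<in> labelled_sunflowers r V w" "w \<le> card V" "r \<ge> 1"
  shows "(card V choose w) * card {t' \<in> labelled_sunflowers r V w. card (edges_of t \<inter> edges_of t') = 1}
           \<le> r * r * card (labelled_sunflowers r V w)"
proof -
  let ?L = "labelled_sunflowers r V w"
  let ?B = "\<Sum>s<w. (w choose s) * (r * completions (card V) w s 1 r)"
  have "{t' \<in> ?L. card (edges_of t \<inter> edges_of t') = 1} \<subseteq> (\<Union>e\<in>edges_of t. {t' \<in> ?L. e \<in> edges_of t'})"
    by (auto simp: card_1_singleton_iff)
  then have "card {t' \<in> ?L. card (edges_of t \<inter> edges_of t') = 1} \<le> card (\<Union>e\<in>edges_of t. {t' \<in> ?L. e \<in> edges_of t'})"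
    using assms(1) by (intro card_mono) auto
  also have "\<dots> \<le> (\<Sum>e\<in>edges_of t. card {t' \<in> ?L. e \<in> edges_of t'})"
    by (intro card_UN_le) auto
  also have "\<dots> \<le> (\<Sum>e\<in>edges_of t. ?B)"
    using edges_of_subset[OF assms(1,2)] by (intro sum_mono card_containing_edge[OF assms(1)]) auto
  also have "\<dots> = r * ?B" using card_edges_of[OF assms(2)] by simp
  finally have "(card V choose w) * card {t' \<in> ?L. card (edges_of t \<inter> edges_of t') = 1}
      \<le> (card V choose w) * (r * ?B)" by simp
  also have "\<dots> = r * r * (\<Sum>s<w. (card V choose w) * ((w choose s) * completions (card V) w s 1 r))"
    by (simp add: sum_distrib_left mult_ac)
  also have "\<dots> = r * r * card ?L"
    using assms choose_mult_completions[of _ w "card V" r]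
    by (simp add: card_labelled_sunflowers)
  finally show ?thesis .
qed

text \<open>The geometric mean of the last \<open>r - j\<close> factors is at most that of all of
  them: \<open>c j\<close> bounds the tail factors from above and the first \<open>j\<close> factors
  from below.\<close>

lemma antimono_prod_power_le:
  fixes c :: "nat \<Rightarrow> nat"
  assumes "\<And>i k. i \<le> k \<Longrightarrow> c k \<le> c i" "j \<le> r"
  shows "(\<Prod>i=j..<r. c i) ^ r \<le> (\<Prod>i=0..<r. c i) ^ (r - j)"
proof -
  let ?Q = "\<Prod>i=j..<r. c i" and ?P = "\<Prod>i=0..<j. c i"
  have "?Q \<le> (\<Prod>i=j..<r. c j)" using assms by (intro prod_mono) auto
  then have Q: "?Q \<le> c j ^ (r - j)" by simp
  have "(\<Prod>i=0..<j. c j) \<le> ?P" using assms by (intro prod_mono) auto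
  then have P: "c j ^ j \<le> ?P" by simp
  have "?Q ^ j \<le> (c j ^ (r - j)) ^ j" using Q by (rule power_mono) simp
  also have "\<dots> = (c j ^ j) ^ (r - j)" by (simp add: power_mult[symmetric] mult.commute)
  also have "\<dots> \<le> ?P ^ (r - j)" using P by (rule power_mono) simp
  finally have "?Q ^ j * ?Q ^ (r - j) \<le> ?P ^ (r - j) * ?Q ^ (r - j)" by simp
  then have "?Q ^ r \<le> (?P * ?Q) ^ (r - j)"
    using assms(2) by (simp add: power_add[symmetric] power_mult_distrib)
  also have "?P * ?Q = (\<Prod>i=0..<r. c i)" using assms(2) by (intro prod.atLeastLessThan_concat) auto
  finally show ?thesis .
qed

text \<open>Fewer points remain for each further petal, so the factors decrease. Inserting
  \<open>n choose s\<close>, which is at least 1, turns the base into one summand of the count of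
  labelled sunflowers.\<close>

lemma completions_power_le:
  assumes "j \<le> r" "s \<le> n"
  shows "completions n w s j r ^ r \<le> ((n choose s) * completions n w s 0 r) ^ (r - j)"
proof -
  have "completions n w s j r ^ r \<le> completions n w s 0 r ^ (r - j)"
    unfolding completions_def using assms(1)
    by (intro antimono_prod_power_le binomial_right_mono diff_le_mono2 mult_le_mono1) auto
  also have "\<dots> \<le> ((n choose s) * completions n w s 0 r) ^ (r - j)"
    using assms(2) by (intro power_mono) (auto simp: Suc_le_eq)
  finally show ?thesis .
qed

text \<open>The constant \<open>2 ^ r * fact r\<close> absorbs the combinatorial factors of both
  cases: \<open>r * r\<close> for \<open>j = 1\<close>, and
  \<open>(r choose j) * (fact j * (r choose j))\<close> otherwise.\<close>

lemma card_sharing_le_power: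
  fixes z :: real
  assumes "finite V" "t \<in> labelled_sunflowers r V w" "w \<le> card V" "r \<ge> 2" "1 \<le> j" "j \<le> r"
    and z: "z \<ge> 0" "z ^ r = real (card (labelled_sunflowers r V w))"
  shows "real (card {t' \<in> labelled_sunflowers r V w. card (edges_of t \<inter> edges_of t') = j})
           \<le> 2 ^ r * fact r * z ^ (r - j)"
proof (cases "j = 1")
  case True
  let ?L = "labelled_sunflowers r V w" and ?N = "card V choose w"
  let ?M = "card {t' \<in> ?L. card (edges_of t \<inter> edges_of t') = 1}"
  have zpos: "z > 0"
  proof -
    have "card ?L > 0" using assms(1,2) by (auto simp: card_gt_0_iff)
    then show ?thesis using z assms(4) by (cases "z = 0") (auto simp: power_0_left)
  qed
  \<comment> \<open>The resulting bound \<open>z \<le> ?N\<close> lets the factor \<open>?N\<close>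
    from the double counting be traded for \<open>z\<close>.\<close>
  have "z ^ r \<le> real ?N ^ r"
    unfolding z(2) using card_labelled_sunflowers_le[OF assms(1,4), of w]
    by (simp only: of_nat_power[symmetric] of_nat_mono)
  then have zN: "z \<le> real ?N" by (subst (asm) power_mono_iff) (use z(1) assms(4) in auto)
  have "z * real ?M \<le> real ?N * real ?M" using zN by (intro mult_right_mono) auto
  also have "\<dots> \<le> real r * real r * z ^ r"
  proof -
    have "?N * ?M \<le> r * r * card ?L"
      using assms(4) by (intro card_sharing_one_le assms) auto
    then have "real (?N * ?M) \<le> real (r * r * card ?L)" by (rule of_nat_mono)
    then show ?thesis by (simp add: z(2))
  qed
  also have "z ^ r = z * z ^ (r - 1)" using assms(4) by (simp add: power_eq_if)
  finally have "real ?M \<le> real r * real r * z ^ (r - 1)" using zpos by (simp add: mult_ac)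
  also have "\<dots> \<le> 2 ^ r * fact r * z ^ (r - 1)"
  proof -
    have "real r \<le> 2 ^ r" using less_exp[of r] by (metis of_nat_less_iff of_nat_numeral of_nat_power less_imp_le)
    moreover have "real r \<le> fact r" using fact_ge_self[of r] by (metis of_nat_fact of_nat_mono)
    ultimately show ?thesis using zpos by (intro mult_mono mult_right_mono) auto
  qed
  finally show ?thesis using True by simp
next
  case False
  let ?L = "labelled_sunflowers r V w"
  obtain K ps where t: "t = (K, ps)" by (cases t)
  note D = labelled_sunflowersD[OF assms(2)[unfolded t]]
  let ?Q = "completions (card V) w (card K) j r"
  let ?M = "card {t' \<in> ?L. card (edges_of t \<inter> edges_of t') = j}"
  have "(card V choose card K) * completions (card V) w (card K) 0 r \<le> card ?L"
    unfolding card_labelled_sunflowers[OF assms(1)] using D(2)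
    by (intro member_le_sum[where f = "\<lambda>s. (card V choose s) * completions (card V) w s 0 r"]) auto
  then have "?Q ^ r \<le> card ?L ^ (r - j)"
    using completions_power_le[OF assms(6), of "card K" "card V" w] D(2) assms(3)
    by (meson le_trans less_imp_le power_mono zero_le)
  then have "real ?Q ^ r \<le> (z ^ r) ^ (r - j)"
    unfolding z(2) by (simp only: of_nat_power[symmetric] of_nat_mono)
  also have "\<dots> = (z ^ (r - j)) ^ r" by (simp add: power_mult[symmetric] mult.commute)
  finally have Q: "real ?Q \<le> z ^ (r - j)"
    by (subst (asm) power_mono_iff) (use z(1) assms(4) in auto)
  \<comment> \<open>This product is \<open>fact r / fact (r - j)\<close>.\<close>
  have "fact j * (r choose j) \<le> fact (r - j) * (fact j * (r choose j))"
    by simp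
  also have "\<dots> = (fact r :: nat)" using binomial_fact_lemma[OF assms(6)] by (simp add: mult_ac)
  finally have f: "fact j * (r choose j) \<le> (fact r :: nat)" .
  have "card {t' \<in> ?L. card (edges_of t \<inter> edges_of t') = j} \<le> (r choose j) * (fact j * (r choose j) * ?Q)"
    unfolding t by (rule card_sharing_le) (use assms t False in auto)
  also have "\<dots> \<le> 2 ^ r * (fact r * ?Q)"
    using f by (intro mult_le_mono binomial_le_pow2) auto
  finally have "real ?M \<le> 2 ^ r * fact r * real ?Q"
  proof -
    assume "?M \<le> 2 ^ r * (fact r * ?Q)"
    then have "real ?M \<le> real (2 ^ r * (fact r * ?Q))" by (rule of_nat_mono)
    then show ?thesis by simp
  qed
  also have "\<dots> \<le> 2 ^ r * fact r * z ^ (r - j)" using Q by (intro mult_left_mono) auto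
  finally show ?thesis .
qed

section \<open>The second moment method and edge probabilities\<close>

text \<open>Let \<open>X\<close> count the events that occur, with mean \<mu>. The hypothesis on
  pairs bounds its variance by \<delta> times the square of \<mu>, and \<open>X = 0\<close> is a
  deviation of \<mu>, so Chebyshev's inequality applies.\<close>

lemma second_moment_prob_none:
  fixes M :: "'a pmf" and A :: "'i \<Rightarrow> 'a set"
  assumes "finite I" "\<And>i. i \<in> I \<Longrightarrow> measure_pmf.prob M (A i) = q" "real (card I) * q > 0"
    and "(\<Sum>i\<in>I. \<Sum>j\<in>I. measure_pmf.prob M (A i \<inter> A j)) \<le> (1 + \<delta>) * (real (card I) * q)\<^sup>2"
  shows "measure_pmf.prob M {x. \<forall>i\<in>I. x \<notin> A i} \<le> \<delta>"
proof -
  define X :: "'a \<Rightarrow> real" where "X = (\<lambda>x. \<Sum>i\<in>I. indicator (A i) x)"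
  define \<mu> where "\<mu> = real (card I) * q"
  have X2: "(X x)\<^sup>2 = (\<Sum>i\<in>I. \<Sum>j\<in>I. indicator (A i \<inter> A j) x)" for x
    by (simp add: X_def power2_eq_square sum_product indicator_inter_arith)
  have int: "integrable (measure_pmf M) X" "integrable (measure_pmf M) (\<lambda>x. (X x)\<^sup>2)"
    unfolding X2 by (auto simp: X_def less_top[symmetric] intro!: integrable_real_indicator)
  have EX: "measure_pmf.expectation M X = \<mu>"
    unfolding X_def \<mu>_def using assms(2)
    by (subst Bochner_Integration.integral_sum) (auto simp: less_top[symmetric] intro!: integrable_real_indicator)
  have "measure_pmf.expectation M (\<lambda>x. (X x)\<^sup>2) = (\<Sum>i\<in>I. \<Sum>j\<in>I. measure_pmf.prob M (A i \<inter> A j))"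
    unfolding X2
    by (simp add: Bochner_Integration.integral_sum Bochner_Integration.integrable_sum less_top[symmetric] integrable_real_indicator)
  then have var: "measure_pmf.variance M X \<le> \<delta> * \<mu>\<^sup>2"
    using assms(4) measure_pmf.variance_eq[OF int] by (simp add: EX \<mu>_def algebra_simps)
  have X0: "X x = 0" if "\<forall>i\<in>I. x \<notin> A i" for x
    unfolding X_def using that by (intro sum.neutral) auto
  have "measure_pmf.prob M {x. \<forall>i\<in>I. x \<notin> A i}
      \<le> measure_pmf.prob M {x \<in> space (measure_pmf M). \<bar>X x - measure_pmf.expectation M X\<bar> \<ge> \<mu>}"
    using assms(3) by (intro measure_pmf.finite_measure_mono) (auto simp: EX X0)
  also have "\<dots> \<le> measure_pmf.variance M X / \<mu>\<^sup>2"
    using assms(3) int by (intro measure_pmf.Chebyshev_inequality) (auto simp: \<mu>_def)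
  also have "\<dots> \<le> \<delta>"
  proof -
    have "\<mu>\<^sup>2 > 0" using assms(3) unfolding \<mu>_def by (rule zero_less_power)
    then show ?thesis using var by (simp add: divide_le_eq)
  qed
  finally show ?thesis .
qed

lemma finite_possible_edges [simp, intro]: "finite (possible_edges n w)"
  by (rule finite_subset[of _ "Pow {..<n}"]) (auto simp: possible_edges_def)

text \<open>The event is a product event that leaves the edges outside \<open>S\<close>
  unconstrained.\<close>

lemma prob_random_hypergraph_superset:
  assumes "S \<subseteq> possible_edges n w" "0 \<le> p" "p \<le> 1"
  shows "measure_pmf.prob (random_hypergraph n p w) {H. S \<subseteq> H} = p ^ card S"
proof -
  let ?E = "possible_edges n w"
  have "measure_pmf.prob (random_hypergraph n p w) {H. S \<subseteq> H} =
      measure_pmf.prob (Pi_pmf ?E False (\<lambda>_. bernoulli_pmf p))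
        (Pi ?E (\<lambda>e. if e \<in> S then {True} else UNIV))"
    unfolding random_hypergraph_def measure_map_pmf
    by (rule arg_cong[where f = "measure _"]) (use assms(1) in \<open>auto split: if_splits\<close>)
  also have "\<dots> = (\<Prod>e\<in>?E. if e \<in> S then p else 1)"
    unfolding measure_Pi_pmf_Pi[OF finite_possible_edges]
    using assms(2,3) by (intro prod.cong) (auto simp: measure_pmf_single)
  also have "\<dots> = (\<Prod>e\<in>S. p)"
    using assms(1) by (intro prod.mono_neutral_cong_right) auto
  finally show ?thesis by simp
qed

lemma set_random_hypergraph: "set_pmf (random_hypergraph n p w) \<subseteq> Pow (possible_edges n w)"
  by (auto simp: random_hypergraph_def)

section \<open>The number of labelled sunflowers in terms of \<open>N\<close> and
  \<open>D\<close>\<close>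

text \<open>The product telescopes: up to \<open>fact m\<close>, each binomial is a quotient of
  consecutive \<open>fact (u - i * m)\<close>.\<close>

lemma prod_choose_fact:
  assumes "r * m \<le> u"
  shows "(\<Prod>i=0..<r. (u - i * m) choose m) * (fact m ^ r * fact (u - r * m)) = (fact u :: nat)"
  using assms
proof (induction r)
  case (Suc r)
  have "fact m * fact (u - r * m - m) * ((u - r * m) choose m) = (fact (u - r * m) :: nat)"
    using Suc.prems by (intro binomial_fact_lemma) simp
  moreover have "u - r * m - m = u - Suc r * m" by simp
  ultimately have step: "((u - r * m) choose m) * (fact m * fact (u - Suc r * m)) = (fact (u - r * m) :: nat)"
    by (simp only: mult_ac)
  have "(\<Prod>i=0..<Suc r. (u - i * m) choose m) * (fact m ^ Suc r * fact (u - Suc r * m))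
      = (\<Prod>i=0..<r. (u - i * m) choose m) *
        (fact m ^ r * (((u - r * m) choose m) * (fact m * fact (u - Suc r * m))))"
    by (simp only: prod.atLeast0_lessThan_Suc power_Suc mult_ac)
  then show ?case using Suc by (simp only: step) simp
qed simp

lemma card_fixed_kernel:
  assumes "s < w" "w \<le> n" "r \<ge> 1"
  shows "real ((n choose s) * completions n w s 0 r) =
    (if r * w \<le> n + (r - 1) * s
     then fact n / (fact s * fact (w - s) ^ r * fact (n + (r - 1) * s - r * w)) else 0)"
proof -
  obtain k where k: "r = Suc k" using assms(3) by (cases r) auto
  \<comment> \<open>\<open>m\<close> is the petal size and \<open>u\<close> below the number of
    points outside the kernel; there is room for the petals iff
    \<open>r * m \<le> u\<close>.\<close>
  obtain m where m: "w = s + m" "m > 0" using assms(1) less_imp_add_positive by blast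
  obtain u where u: "n = s + u" using assms by (metis le_add_diff_inverse less_imp_le order_trans)
  have iff: "r * w \<le> n + (r - 1) * s \<longleftrightarrow> r * m \<le> u"
    by (simp add: k m u algebra_simps)
  have diff: "n + (r - 1) * s - r * w = u - r * m"
    by (simp add: k m u algebra_simps)
  have comp: "completions n w s 0 r = (\<Prod>i=0..<r. (u - i * m) choose m)"
    by (simp add: completions_def m u)
  show ?thesis
  proof (cases "r * m \<le> u")
    case True
    have "real ((\<Prod>i=0..<r. (u - i * m) choose m) * (fact m ^ r * fact (u - r * m))) = real (fact u)"
      using prod_choose_fact[OF True] by simp
    then have A: "real (completions n w s 0 r) = fact u / (fact m ^ r * fact (u - r * m))"
      by (simp add: comp field_simps)
    have "real (fact s * fact u * (n choose s)) = real (fact n)"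
      using binomial_fact_lemma[of s n] by (simp add: u)
    then have B: "real (n choose s) = fact n / (fact s * fact u)"
      by (simp add: field_simps)
    show ?thesis unfolding of_nat_mult A B iff diff using True by (simp add: m)
  next
    case False
    \<comment> \<open>Without room for all petals, the factor of the last one, \<open>i = k\<close>,
      vanishes, even if the difference truncates.\<close>
    have "u < m + k * m" using False by (simp add: k)
    then have "u - k * m < m" using m(2) by arith
    then have "(u - k * m) choose m = 0" by (rule binomial_eq_0)
    then have "completions n w s 0 r = 0"
      unfolding comp by (intro prod_zero bexI[of _ k]) (auto simp: k)
    then show ?thesis unfolding iff using False by simp
  qed
qed

text \<open>Multiplying the summand for \<open>s\<close> by \<open>n choose w\<close> cancels
  \<open>fact w * fact (n - w)\<close>, which leaves the count for kernels of size \<open>s\<close>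
  divided by \<open>fact (r - 1)\<close>.\<close>

lemma card_labelled_sunflowers_eq:
  assumes "w \<le> n" "r \<ge> 1"
  shows "real (card (labelled_sunflowers r {..<n} w)) =
           fact (r - 1) * (real (num_edges n w) * sunflower_degree r n w)"
proof -
  have N: "real (n choose w) = fact n / (fact w * fact (n - w))"
    using assms(1) by (rule binomial_fact)
  have "real (card (labelled_sunflowers r {..<n} w)) = (\<Sum>s<w. real ((n choose s) * completions n w s 0 r))"
    by (simp add: card_labelled_sunflowers)
  also have "\<dots> = (\<Sum>s<w. fact (r - 1) * (real (n choose w) *
       (if r * w \<le> n + (r - 1) * s
            then fact w * fact (n - w) /
                 (fact (r - 1) * fact s * fact (w - s) ^ r * fact (n + (r - 1) * s - r * w))
            else 0)))"
    using assms by (intro sum.cong refl) (subst card_fixed_kernel, auto simp: N)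
  finally show ?thesis
    by (simp add: sunflower_degree_def num_edges_def sum_distrib_left)
qed

section \<open>Probability bounds for fixed \<open>n\<close>\<close>

lemma edges_of_possible_edges:
  assumes "t \<in> labelled_sunflowers r {..<n} w"
  shows "edges_of t \<subseteq> possible_edges n w"
  using edges_of_subset[OF _ assms] by (auto simp: possible_edges_def)

text \<open>The first moment bound: a union bound over labelled sunflowers, each present with
  probability \<open>p ^ r\<close>.\<close>

lemma prob_sunflower_le:
  assumes "r \<ge> 2" "0 \<le> p" "p \<le> 1"
  shows "measure_pmf.prob (random_hypergraph n p w) {H. contains_sunflower r H}
           \<le> real (card (labelled_sunflowers r {..<n} w)) * p ^ r"
proof -
  let ?M = "random_hypergraph n p w" and ?L = "labelled_sunflowers r {..<n} w"
  \<comment> \<open>On the support all edges are \<open>w\<close>-subsets of \<open>{..<n}\<close>,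
    as \<open>sunflower_imp_labelled\<close> requires.\<close>
  have "measure_pmf.prob ?M {H. contains_sunflower r H} =
      measure_pmf.prob ?M ({H. contains_sunflower r H} \<inter> set_pmf ?M)"
    by (simp add: measure_Int_set_pmf)
  also have "\<dots> \<le> measure_pmf.prob ?M (\<Union>t\<in>?L. {H. edges_of t \<subseteq> H})"
  proof (rule measure_pmf.finite_measure_mono)
    show "{H. contains_sunflower r H} \<inter> set_pmf ?M \<subseteq> (\<Union>t\<in>?L. {H. edges_of t \<subseteq> H})"
    proof
      fix H assume H: "H \<in> {H. contains_sunflower r H} \<inter> set_pmf ?M"
      then obtain S where S: "S \<subseteq> H" "sunflower r S" by (auto simp: contains_sunflower_def)
      have "H \<subseteq> possible_edges n w" using H set_random_hypergraph[of n p w] by auto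
      then have "\<And>e. e \<in> S \<Longrightarrow> e \<subseteq> {..<n} \<and> card e = w" using S by (auto simp: possible_edges_def)
      then obtain t where "t \<in> ?L" "edges_of t = S"
        using sunflower_imp_labelled[of "{..<n}" r S w] S(2) assms(1) by auto
      then show "H \<in> (\<Union>t\<in>?L. {H. edges_of t \<subseteq> H})" using S by auto
    qed
  qed simp
  also have "\<dots> \<le> (\<Sum>t\<in>?L. measure_pmf.prob ?M {H. edges_of t \<subseteq> H})"
    by (intro measure_pmf.finite_measure_subadditive_finite) auto
  also have "\<dots> = (\<Sum>t\<in>?L. p ^ r)"
    using assms(2,3) card_edges_of[of _ r "{..<n}" w]
    by (intro sum.cong refl) (simp add: prob_random_hypergraph_superset edges_of_possible_edges)
  finally show ?thesis by simp
qed

text \<open>Group the \<open>t'\<close> by the number \<open>j\<close> of shared edges; the union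
  then has \<open>2 * r - j\<close> edges. The term \<open>j = 0\<close> gives the main term 1, and
  each of the \<open>r\<close> others is smaller by a factor of order
  \<open>1 / (p * z)\<close>.\<close>

lemma sum_pairs_le:
  fixes p z :: real
  assumes "r \<ge> 2" "w \<le> n" "t \<in> labelled_sunflowers r {..<n} w" "0 < p" "p * z \<ge> 1" "z \<ge> 0"
    and z: "z ^ r = real (card (labelled_sunflowers r {..<n} w))"
  shows "(\<Sum>t'\<in>labelled_sunflowers r {..<n} w. p ^ card (edges_of t \<union> edges_of t'))
           \<le> (1 + real r * 2 ^ r * fact r / (p * z)) * (p ^ r)\<^sup>2 * z ^ r"
proof -
  let ?L = "labelled_sunflowers r {..<n} w"
  let ?c = "\<lambda>t'. card (edges_of t \<inter> edges_of t')"
  let ?M = "\<lambda>j. {t' \<in> ?L. ?c t' = j}"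
  define C :: real where "C = 2 ^ r * fact r"
  have union: "card (edges_of t \<union> edges_of t') = 2 * r - ?c t'" if "t' \<in> ?L" for t'
    using card_Un_Int[of "edges_of t" "edges_of t'"] card_edges_of[OF assms(3)] card_edges_of[OF that] by simp
  have le: "?c t' \<le> r" for t'
    using card_mono[of "edges_of t" "edges_of t \<inter> edges_of t'"] card_edges_of[OF assms(3)] by simp
  have share: "real (card (?M j)) * p ^ (2 * r - j) \<le> C / (p * z) * (p ^ r)\<^sup>2 * z ^ r"
    if j: "j \<in> {1..r}" for j
  proof -
    have "real (card (?M j)) * p ^ (2 * r - j) \<le> C * z ^ (r - j) * p ^ (2 * r - j)"
      unfolding C_def using j assms z
      by (intro mult_right_mono card_sharing_le_power) auto
    also have "\<dots> = C * (p ^ r * (p * z) ^ (r - j))"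
      using j by (simp add: power_mult_distrib power_add[symmetric] mult_2)
    \<comment> \<open>As \<open>p * z \<ge> 1\<close>, the case \<open>j = 1\<close>
      dominates.\<close>
    also have "\<dots> \<le> C * (p ^ r * (p * z) ^ (r - 1))"
      using j assms by (intro mult_left_mono power_increasing) (auto simp: C_def)
    also have "(p * z) ^ (r - 1) = (p * z) ^ r / (p * z)"
      using assms by (subst power_diff) auto
    also have "C * (p ^ r * ((p * z) ^ r / (p * z))) = C / (p * z) * (p ^ r)\<^sup>2 * z ^ r"
      by (simp add: power_mult_distrib power2_eq_square)
    finally show ?thesis .
  qed
  have "(\<Sum>t'\<in>?L. p ^ card (edges_of t \<union> edges_of t')) = (\<Sum>t'\<in>?L. p ^ (2 * r - ?c t'))"
    by (intro sum.cong refl) (simp add: union)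
  also have "\<dots> = (\<Sum>j\<in>{0..r}. \<Sum>t'\<in>?M j. p ^ (2 * r - ?c t'))"
    using le by (intro sum.group[symmetric]) auto
  also have "\<dots> = (\<Sum>j\<in>{0..r}. real (card (?M j)) * p ^ (2 * r - j))"
    by (intro sum.cong refl) simp
  also have "\<dots> = real (card (?M 0)) * p ^ (2 * r) + (\<Sum>j\<in>{1..r}. real (card (?M j)) * p ^ (2 * r - j))"
    by (simp add: sum.atLeast_Suc_atMost)
  also have "\<dots> \<le> z ^ r * p ^ (2 * r) + (\<Sum>j\<in>{1..r}. C / (p * z) * (p ^ r)\<^sup>2 * z ^ r)"
  proof (intro add_mono sum_mono share mult_right_mono)
    show "real (card (?M 0)) \<le> z ^ r" unfolding z by (intro of_nat_mono card_mono) auto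
  qed (use assms in auto)
  also have "\<dots> = (1 + r * C / (p * z)) * (p ^ r)\<^sup>2 * z ^ r"
  proof -
    have "p ^ (2 * r) = (p ^ r)\<^sup>2" by (simp add: power_mult[symmetric] mult.commute)
    then show ?thesis by (simp only:) (simp add: algebra_simps)
  qed
  finally show ?thesis by (simp add: C_def mult.assoc)
qed

text \<open>The second moment method for the events that all edges of \<open>t\<close> are present;
  \<open>sum_pairs_le\<close> bounds the sum over \<open>t'\<close> for each fixed
  \<open>t\<close>.\<close>

lemma prob_no_sunflower_le:
  fixes p z :: real
  assumes "r \<ge> 2" "w \<le> n" "0 < p" "p \<le> 1" "p * z \<ge> 1" "z \<ge> 0"
    and z: "z ^ r = real (card (labelled_sunflowers r {..<n} w))"
  shows "measure_pmf.prob (random_hypergraph n p w) {H. \<not> contains_sunflower r H}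
           \<le> real r * 2 ^ r * fact r / (p * z)"
proof -
  let ?M = "random_hypergraph n p w" and ?L = "labelled_sunflowers r {..<n} w"
  let ?\<delta> = "real r * 2 ^ r * fact r / (p * z)"
  have zpos: "z > 0" using assms by (cases "z = 0") auto
  have "{H. \<not> contains_sunflower r H} \<subseteq> {H. \<forall>t\<in>?L. H \<notin> {H. edges_of t \<subseteq> H}}"
    unfolding contains_sunflower_def using sunflower_edges_of by blast
  then have "measure_pmf.prob ?M {H. \<not> contains_sunflower r H}
      \<le> measure_pmf.prob ?M {H. \<forall>t\<in>?L. H \<notin> {H. edges_of t \<subseteq> H}}"
    by (intro measure_pmf.finite_measure_mono) auto
  also have "\<dots> \<le> ?\<delta>"
  proof (rule second_moment_prob_none)
    show "measure_pmf.prob ?M {H. edges_of t \<subseteq> H} = p ^ r" if "t \<in> ?L" for t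
      using assms that card_edges_of[OF that]
      by (simp add: prob_random_hypergraph_superset edges_of_possible_edges)
    show "0 < real (card ?L) * p ^ r"
      unfolding z[symmetric] using zpos assms(3) by (intro mult_pos_pos zero_less_power)
    have "(\<Sum>t\<in>?L. \<Sum>t'\<in>?L. measure_pmf.prob ?M ({H. edges_of t \<subseteq> H} \<inter> {H. edges_of t' \<subseteq> H}))
       = (\<Sum>t\<in>?L. \<Sum>t'\<in>?L. p ^ card (edges_of t \<union> edges_of t'))"
    proof (intro sum.cong refl)
      fix t t' assume t: "t \<in> ?L" "t' \<in> ?L"
      have "{H. edges_of t \<subseteq> H} \<inter> {H. edges_of t' \<subseteq> H} = {H. edges_of t \<union> edges_of t' \<subseteq> H}" by auto
      then show "measure_pmf.prob ?M ({H. edges_of t \<subseteq> H} \<inter> {H. edges_of t' \<subseteq> H}) =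
          p ^ card (edges_of t \<union> edges_of t')"
        using assms edges_of_possible_edges[OF t(1)] edges_of_possible_edges[OF t(2)]
        by (simp only:) (intro prob_random_hypergraph_superset, auto)
    qed
    also have "\<dots> \<le> (\<Sum>t\<in>?L. (1 + ?\<delta>) * (p ^ r)\<^sup>2 * z ^ r)"
      using sum_pairs_le[OF assms(1,2) _ assms(3,5,6) z] by (rule sum_mono)
    also have "\<dots> = (1 + ?\<delta>) * (real (card ?L) * p ^ r)\<^sup>2"
      by (simp add: z power2_eq_square)
    finally show "(\<Sum>t\<in>?L. \<Sum>t'\<in>?L. measure_pmf.prob ?M ({H. edges_of t \<subseteq> H} \<inter> {H. edges_of t' \<subseteq> H}))
        \<le> (1 + ?\<delta>) * (real (card ?L) * p ^ r)\<^sup>2" .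
  qed auto
  finally show ?thesis .
qed

section \<open>The threshold as \<open>n\<close> tends to infinity\<close>

text \<open>The summand \<open>s = w - 1\<close> is positive: its petals are single points, so
  \<open>w + r - 1\<close> points suffice.\<close>

lemma sunflower_degree_pos:
  assumes "0 < w" "w + r \<le> n" "r \<ge> 1"
  shows "sunflower_degree r n w > 0"
proof -
  obtain k v where kv: "r = Suc k" "w = Suc v" using assms by (cases r; cases w) auto
  show ?thesis
    unfolding sunflower_degree_def
  proof (rule sum_pos2[of _ v])
    have "r * w \<le> n + (r - 1) * v" using assms by (simp add: kv algebra_simps)
    then show "0 < (if r * w \<le> n + (r - 1) * v
            then fact w * fact (n - w) /
                 (fact (r - 1) * fact v * fact (w - v) ^ r * fact (n + (r - 1) * v - r * w))
            else 0 :: real)" by simp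
  qed (auto simp: kv)
qed

theorem proposition1p2:
  fixes r :: nat and \<alpha> :: real and w :: "nat \<Rightarrow> nat" and p :: "nat \<Rightarrow> real"
  assumes "r \<ge> 2"
    and "1 / 2 < \<alpha>" and "\<alpha> < 1"
    and "\<And>n. \<bar>real (w n) - real n powr \<alpha>\<bar> < 1"
    and "\<And>n. 0 \<le> p n" and "\<And>n. p n \<le> 1"
  shows "(p \<in> o(\<lambda>n. (real (num_edges n (w n)) * sunflower_degree r n (w n)) powr (- 1 / real r))
            \<longrightarrow> (\<lambda>n. measure_pmf.prob (random_hypergraph n (p n) (w n)) {H. contains_sunflower r H})
                  \<longlonglongrightarrow> 0)
       \<and> (p \<in> \<omega>(\<lambda>n. (real (num_edges n (w n)) * sunflower_degree r n (w n)) powr (- 1 / real r))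
            \<longrightarrow> (\<lambda>n. measure_pmf.prob (random_hypergraph n (p n) (w n)) {H. contains_sunflower r H})
                  \<longlonglongrightarrow> 1)"
proof -
  define B where "B = (\<lambda>n. real (num_edges n (w n)) * sunflower_degree r n (w n))"
  define g where "g = (\<lambda>n. B n powr (- 1 / real r))"
  define P where "P = (\<lambda>n. measure_pmf.prob (random_hypergraph n (p n) (w n)) {H. contains_sunflower r H})"
  let ?T = "\<lambda>n. real (card (labelled_sunflowers r {..<n} (w n)))"
  have "filterlim (\<lambda>n. real n powr \<alpha>) at_top at_top"
    using assms(2) by real_asymp
  then have "\<forall>\<^sub>F n in at_top. real n powr \<alpha> \<ge> 1"
    by (auto simp: filterlim_at_top)
  moreover have "filterlim (\<lambda>n. real n - real n powr \<alpha>) at_top at_top"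
    using assms(2,3) by real_asymp
  then have "\<forall>\<^sub>F n in at_top. real n - real n powr \<alpha> \<ge> real r + 1"
    by (auto simp: filterlim_at_top)
  \<comment> \<open>As \<open>w n\<close> differs from its target by less than 1, the two bounds
    above give \<open>w n > 0\<close> and \<open>w n + r \<le> n\<close>.\<close>
  ultimately have "\<forall>\<^sub>F n in at_top. 0 < w n \<and> w n + r \<le> n"
  proof eventually_elim
    case (elim n)
    have "\<bar>real (w n) - real n powr \<alpha>\<bar> < 1" by (rule assms(4))
    then have "real (w n) > 0" "real (w n + r) \<le> real n" using elim by (auto simp: abs_less_iff)
    then show ?case by auto
  qed
  then have ev: "\<forall>\<^sub>F n in at_top. w n \<le> n \<and> B n > 0 \<and> ?T n = fact (r - 1) * B n"
  proof eventually_elim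
    case (elim n)
    then show ?case
      using assms(1) sunflower_degree_pos[of "w n" r n] card_labelled_sunflowers_eq[of "w n" n r]
      by (auto simp: B_def num_edges_def)
  qed
  have ev_g: "\<forall>\<^sub>F n in at_top. g n \<noteq> 0"
    using ev by eventually_elim (auto simp: g_def)
  \<comment> \<open>\<open>1 / g n\<close> is the \<open>r\<close>-th root of \<open>B n\<close>;
    the root \<open>z\<close> of the labelled count exceeds it at most by the constant factor
    \<open>root r (fact (r - 1))\<close>.\<close>
  have root: "(1 / g n) ^ r = B n" if "B n > 0" for n
  proof -
    have "1 / g n = B n powr (1 / real r)" by (simp add: g_def powr_minus_divide)
    then show ?thesis using that assms(1) by (simp add: powr_power)
  qed
  have "P \<longlonglongrightarrow> 0" if "p \<in> o(g)"
  proof (rule tendsto_sandwich[OF _ _ tendsto_const])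
    have "(\<lambda>n. p n / g n) \<longlonglongrightarrow> 0" using that by (rule smalloD_tendsto)
    then have "(\<lambda>n. fact (r - 1) * (p n / g n) ^ r) \<longlonglongrightarrow> fact (r - 1) * 0 ^ r"
      by (intro tendsto_intros)
    then show "(\<lambda>n. fact (r - 1) * (p n / g n) ^ r) \<longlonglongrightarrow> 0"
      using assms(1) by (simp only: power_0_left) simp
    show "\<forall>\<^sub>F n in at_top. P n \<le> fact (r - 1) * (p n / g n) ^ r"
      using ev
    proof eventually_elim
      case (elim n)
      have "P n \<le> ?T n * p n ^ r"
        unfolding P_def by (rule prob_sunflower_le) (use assms in auto)
      also have "\<dots> = fact (r - 1) * ((1 / g n) ^ r * p n ^ r)" using elim root by simp
      also have "\<dots> = fact (r - 1) * (p n / g n) ^ r" by (simp add: power_divide)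
      finally show ?case .
    qed
  qed (auto simp: P_def)
  moreover have "P \<longlonglongrightarrow> 1" if "p \<in> \<omega>(g)"
  proof (rule tendsto_sandwich[OF _ _ _ tendsto_const])
    let ?C = "real r * 2 ^ r * fact r"
    have "filterlim (\<lambda>n. norm (p n / g n)) at_top at_top"
      using that ev_g by (rule smallomegaD_filterlim_at_top_norm)
    moreover have "norm (p n / g n) = p n / g n" for n
      using assms(5)[of n] by (simp add: g_def)
    ultimately have lim: "filterlim (\<lambda>n. p n / g n) at_top at_top" by simp
    have "(\<lambda>n. 1 - ?C / (p n / g n)) \<longlonglongrightarrow> 1 - 0"
      by (intro tendsto_diff tendsto_const tendsto_divide_0[OF tendsto_const] filterlim_at_top_imp_at_infinity lim)
    then show "(\<lambda>n. 1 - ?C / (p n / g n)) \<longlonglongrightarrow> 1" by simp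
    have "\<forall>\<^sub>F n in at_top. p n / g n \<ge> 1" using lim by (auto simp: filterlim_at_top)
    then show "\<forall>\<^sub>F n in at_top. 1 - ?C / (p n / g n) \<le> P n"
      using ev
    proof eventually_elim
      case (elim n)
      define z where "z = root r (?T n)"
      have gpos: "g n > 0" using elim by (simp add: g_def)
      have z: "z ^ r = ?T n" "z \<ge> 0" using assms(1) by (simp_all add: z_def)
      \<comment> \<open>The labelled count is \<open>fact (r - 1) * B n\<close>, hence at least
        \<open>B n\<close>. So \<open>p n * z \<ge> p n / g n\<close>, which is at least 1 and tends
        to infinity.\<close>
      have "(1 / g n) ^ r \<le> z ^ r"
        unfolding z using elim root[of n] fact_ge_1[of "r - 1", where 'a = real]
        by simp
      then have zg: "1 / g n \<le> z"
        by (subst (asm) power_mono_iff) (use z gpos assms(1) in auto)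
      then have pz: "p n / g n \<le> p n * z" using mult_left_mono[OF zg assms(5)[of n]] by simp
      have "p n > 0" using elim assms(5)[of n] by (cases "p n = 0") auto
      then have "measure_pmf.prob (random_hypergraph n (p n) (w n)) {H. \<not> contains_sunflower r H} \<le> ?C / (p n * z)"
        using assms elim pz z by (intro prob_no_sunflower_le) auto
      also have "\<dots> \<le> ?C / (p n / g n)"
      proof (rule divide_left_mono)
        have "0 < p n / g n" "0 < p n * z" using elim pz by linarith+
        then show "0 < p n * z * (p n / g n)" by (rule mult_pos_pos[rotated])
      qed (use pz in auto)
      also have "measure_pmf.prob (random_hypergraph n (p n) (w n)) {H. \<not> contains_sunflower r H} = 1 - P n"
        unfolding P_def using measure_pmf.prob_compl[of "{H. contains_sunflower r H}" "random_hypergraph n (p n) (w n)"]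
        by (simp add: Compl_eq_Diff_UNIV[symmetric] Collect_neg_eq)
      finally show ?case by simp
    qed
  qed (auto simp: P_def)
  ultimately show ?thesis unfolding B_def g_def P_def by blast
qed

end
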